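(* Let $\mathcal{A}$ be a finite alphabet and let $X\subseteq\mathcal{A}^{\mathbb{Z}}$ be a topologically transitive subshift. Then $X$ is language stable if and only if $X$ is entropy stable.
   Context: A subshift $X\subseteq\mathcal{A}^{\mathbb{Z}}$ ($\mathcal{A}$ a finite alphabet) is a nonempty, closed set invariant under the left shift $\sigma$. $\mathcal{L}_n(X)$ is the set of words of length $n$ that occur in some element of $X$, and $\mathcal{L}(X)=\bigcup_n\mathcal{L}_n(X)$. $X$ is topologically transitive if for all $u,v\in\mathcal{L}(X)$ there is a word $w$ with $uwv\in\mathcal{L}(X)$. The SFT cover of $X$ is the sequence $\{X_n\}_{n\geq 1}$, where $X_n$ is the set of all $x\in\mathcal{A}^{\mathbb{Z}}$ in which no word of $\bigcup_{k=1}^n(\mathcal{A}^k\setminus\mathcal{L}_k(X))$ occurs. Thus $X_1\supseteq X_2\supseteq\cdots$ and $X=\bigcap_nX_n$. $X$ is language stable if for every $j\in\mathbb{N}$ there exists $m\in\mathbb{N}$ such that $X_m=X_{m+j}$. $h_{\mathrm{top}}$ denotes topological entropy (natural logarithm). For a positive integer $s$ put $$\xi(s)=\frac{30\,s^{3(s^2+1)}}{1-\left(1-\frac{1}{4s^{2s^2}}\right)^{1/s^2}}.$$ A topologically transitive subshift $X$ is entropy stable if for every $\varepsilon>0$ and all integers $\ell,j\geq 1$ there is an integer $m=m(\varepsilon,\ell,j)\geq 1$ such that $$\bigl|h_{\mathrm{top}}(X_m)-h_{\mathrm{top}}(X_{m+j})\bigr|<\frac{\varepsilon^2}{\left(\frac43\right)^{2\ell}\xi(s_m)^2},$$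 where $s_m=|\mathcal{L}_m(X_m)|$ is the number of admissible words of length $m$ in $X_m$. *)

theory Defs
  imports "HOL-Analysis.Analysis"
begin

definition shift :: "(int \<Rightarrow> 'a) \<Rightarrow> int \<Rightarrow> 'a" where
  "shift x = (\<lambda>i. x (i + 1))"

(* Invariance is the equality shift ` X = X, not just an inclusion: the orbit {shift^n x. n >= 0}
   of the two-sided sequence x with a single 1, together with the zero sequence, is closed and is
   mapped strictly into itself. *)
definition subshift :: "(int \<Rightarrow> 'a::finite) set \<Rightarrow> bool" where
  "subshift X \<longleftrightarrow>
     X \<noteq> {} \<and>
     closedin (product_topology (\<lambda>_::int. discrete_topology (UNIV :: 'a set)) UNIV) X \<and>
     shift ` X = X"

definition occurs_in :: "'a list \<Rightarrow> (int \<Rightarrow> 'a) \<Rightarrow> bool" where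
  "occurs_in w x \<longleftrightarrow> (\<exists>i::int. \<forall>k<length w. x (i + int k) = w ! k)"

definition lang_n :: "nat \<Rightarrow> (int \<Rightarrow> 'a) set \<Rightarrow> 'a list set" where
  "lang_n n X = {w. length w = n \<and> (\<exists>x\<in>X. occurs_in w x)}"

definition lang :: "(int \<Rightarrow> 'a) set \<Rightarrow> 'a list set" where
  "lang X = (\<Union>n. lang_n n X)"

definition top_transitive :: "(int \<Rightarrow> 'a) set \<Rightarrow> bool" where
  "top_transitive X \<longleftrightarrow> (\<forall>u\<in>lang X. \<forall>v\<in>lang X. \<exists>w. u @ w @ v \<in> lang X)"

(* The cover is indexed by n >= 1; for n = 0 this formula gives the full shift, a value that is
   never used below. *)
definition sft_cover :: "(int \<Rightarrow> 'a) set \<Rightarrow> nat \<Rightarrow> (int \<Rightarrow> 'a) set" where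
  "sft_cover X n = {x. \<forall>w \<in> (\<Union>k\<in>{1..n}. {w. length w = k} - lang_n k X). \<not> occurs_in w x}"

definition language_stable :: "(int \<Rightarrow> 'a) set \<Rightarrow> bool" where
  "language_stable X \<longleftrightarrow> (\<forall>j::nat. \<exists>m\<ge>1. sft_cover X m = sft_cover X (m + j))"

(* Topological entropy of a subshift as the exponential growth rate of its words; the limit exists
   for every subshift because n |-> ln |L_n(X)| is subadditive. *)
definition h_top :: "(int \<Rightarrow> 'a::finite) set \<Rightarrow> real" where
  "h_top X = lim (\<lambda>n. ln (real (card (lang_n n X))) / real n)"

definition xi :: "nat \<Rightarrow> real" where
  "xi s = 30 * real s ^ (3 * (s\<^sup>2 + 1)) /
            (1 - (1 - 1 / (4 * real s ^ (2 * s\<^sup>2))) powr (1 / real (s\<^sup>2)))"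

definition entropy_stable :: "(int \<Rightarrow> 'a::finite) set \<Rightarrow> bool" where
  "entropy_stable X \<longleftrightarrow>
     (\<forall>\<epsilon>::real. \<forall>l j::nat. \<epsilon> > 0 \<longrightarrow> l \<ge> 1 \<longrightarrow> j \<ge> 1 \<longrightarrow>
       (\<exists>m\<ge>1. \<bar>h_top (sft_cover X m) - h_top (sft_cover X (m + j))\<bar>
               < \<epsilon>\<^sup>2 / ((4/3) ^ (2 * l) * (xi (card (lang_n m (sft_cover X m))))\<^sup>2)))"

end

theory Submission
  imports Defs
begin

text \<open>
  If \<^term>\<open>sft_cover X m = sft_cover X (m + j)\<close>, the two entropies agree while the threshold of entropy
  stability is positive, so language stability gives entropy stability at once.

  The converse rests on a quantitative form of the fact that an irreducible Markov shift loses entropy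
  when a word is forbidden. Write \<open>Y\<close> and \<open>Z\<close> for the covers of index \<open>m\<close> and \<open>m + j\<close>, \<open>h\<close> for
  the entropy of \<open>Y\<close>, and \<open>s\<close> for the number of words of length \<open>m\<close> in \<open>Y\<close>. Membership in \<open>Y\<close> is
  decided by windows of length \<open>m\<close>, so two admissible words glue along an overlap of length \<open>m\<close>;
  and since \<open>X\<close> and \<open>Y\<close> share their words of length \<open>m\<close>, transitivity of \<open>X\<close> makes \<open>Y\<close>
  irreducible (\<open>irreducible_sft_cover\<close>). If \<open>Z \<noteq> Y\<close>, then some word \<open>P\<close> of length at most \<open>m + j\<close>
  occurs in \<open>Y\<close> but not in \<open>Z\<close>.

  A bare count of words does not show how much is lost by forbidding \<open>P\<close>, because the number of
  continuations of a word depends on where it ends. This is corrected by a weight. For \<open>\<mu> > exp h\<close>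
  let the weight of \<open>u\<close> be \<open>\<Sum>n. F n u / \<mu> ^ n\<close>, where \<open>F n u\<close> is the number of
  continuations of \<open>u\<close> by \<open>n\<close> letters. It is a positive supersolution of the Perron eigenvalue equation:
  the weights of the continuations of \<open>u\<close> by \<open>k\<close> letters add up to at most \<open>\<mu> ^ k\<close> times the weight
  of \<open>u\<close> (\<open>sum_extension_weight_le\<close>). Any two words of length \<open>m\<close> are joined by at most \<open>s\<^sup>2\<close> letters
  (\<open>short_connection\<close>), so every word \<open>u\<close> of length at least \<open>m\<close> has a continuation by \<open>T = s\<^sup>2 + j\<close> letters that runs
  through \<open>P\<close>, and from there at most \<open>s\<^sup>2\<close> further letters lead back to the state in which \<open>u\<close> ended.
  Hence this one continuation carries at least \<open>\<mu> ^ (- s\<^sup>2)\<close> times the weight of \<open>u\<close>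
  (\<open>heavy_follower_containing\<close>), and it is missing in \<open>Z\<close>. The total weight of the words of \<open>Z\<close>
  therefore grows by a factor of at most \<open>\<mu> ^ T - \<mu> ^ (- s\<^sup>2)\<close> per \<open>T\<close> letters. Letting \<open>\<mu>\<close> tend to
  \<open>exp h \<le> s\<close> yields an entropy gap of at least \<open>1 / ((s\<^sup>2 + j) s ^ (2 s\<^sup>2 + j))\<close> (\<open>entropy_gap\<close>).

  On the other side \<open>\<xi>(s) \<ge> 30 s ^ (3 (s\<^sup>2 + 1))\<close>. The exponent \<open>6 s\<^sup>2\<close> in \<open>\<xi>(s)\<^sup>2\<close> beats \<open>2 s\<^sup>2\<close>, and
  the factor depending on \<open>j\<close> alone is absorbed by \<open>\<epsilon>\<close>: with \<open>\<epsilon>\<^sup>2 = (j + 1) ^ (- (j + 1))\<close> the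
  threshold never exceeds the gap, whatever \<open>m\<close> is (\<open>gap_ge_threshold\<close>). So the index \<open>m\<close> provided
  by entropy stability for this \<open>\<epsilon>\<close> satisfies \<open>Z = Y\<close>.
\<close>

section \<open>Growth rates of subadditive sequences\<close>

text \<open>
  Fekete's lemma. The limit is the infimum of the quotients \<open>f n / n\<close>, which is why every single \<open>f n\<close>
  bounds it. Applied to logarithmic word counts, it turns every upper bound for a word count into one for the entropy.
\<close>

lemma subadditive_growth_rate:
  fixes f :: "nat \<Rightarrow> real"
  assumes nonneg: "\<And>n. 0 \<le> f n"
    and subadd: "\<And>m n. f (m + n) \<le> f m + f n"
  obtains L where "(\<lambda>n. f n / real n) \<longlonglongrightarrow> L" and "\<And>n. real n * L \<le> f n"
proof -
  define S where "S = (\<lambda>n. f n / real n) ` {1..}"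
  define L where "L = Inf S"
  have bdd: "bdd_below S" unfolding S_def by (rule bdd_belowI[of _ 0]) (auto simp: nonneg)
  have ne: "S \<noteq> {}" by (auto simp: S_def)
  have lower: "L \<le> f n / real n" if "n \<ge> 1" for n
    unfolding L_def by (rule cInf_lower[OF _ bdd]) (use that in \<open>auto simp: S_def\<close>)
  have multiple: "f (q * N) \<le> real q * f N + f 0" for q N
  proof (induction q)
    case (Suc q)
    have "f (Suc q * N) \<le> f N + f (q * N)" using subadd[of N "q * N"] by simp
    with Suc show ?case by (simp add: algebra_simps)
  qed simp
  \<comment> \<open>Choose \<open>N\<close> with \<open>f N / N\<close> near the infimum and cut \<open>n\<close> into blocks of length \<open>N\<close>; the incomplete
     block costs a constant, which disappears after division by \<open>n\<close>.\<close>
  have upper: "eventually (\<lambda>n. f n / real n < a) sequentially" if "L < a" for a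
  proof -
    define e where "e = (a - L) / 2"
    have e: "e > 0" using that by (simp add: e_def)
    have "\<exists>y\<in>S. y < L + e"
      using cInf_lessD[OF ne, of "L + e"] e by (auto simp: L_def)
    then obtain N where N: "N \<ge> 1" "f N / real N < L + e" by (auto simp: S_def)
    define C where "C = f 0 + (\<Sum>r<N. f r)"
    have bound: "f n / real n \<le> f N / real N + C / real n" if n: "n \<ge> 1" for n
    proof -
      have "f n \<le> f (n div N * N) + f (n mod N)" using subadd[of "n div N * N" "n mod N"] by simp
      also have "f (n mod N) \<le> (\<Sum>r<N. f r)"
        by (rule member_le_sum) (use N nonneg in auto)
      also have "f (n div N * N) \<le> real (n div N) * f N + f 0" by (rule multiple)
      also have "real (n div N) * f N \<le> (real n / real N) * f N"
        by (intro mult_right_mono nonneg) (rule of_nat_div_le_of_nat)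
      finally have "f n \<le> (real n / real N) * f N + C" by (simp add: C_def)
      then have "f n / real n \<le> ((real n / real N) * f N + C) / real n"
        by (rule divide_right_mono) simp
      also have "\<dots> = f N / real N + C / real n" using n by (simp add: add_divide_distrib)
      finally show ?thesis .
    qed
    have "(\<lambda>n. C / real n) \<longlonglongrightarrow> 0" by (rule lim_const_over_n)
    then have "eventually (\<lambda>n. C / real n < e) sequentially"
      by (rule order_tendstoD) (rule e)
    then show ?thesis using eventually_ge_at_top[of 1]
    proof eventually_elim
      case (elim n)
      with bound[of n] N(2) have "f n / real n < L + e + e" by linarith
      then show ?case by (simp add: e_def)
    qed
  qed
  have "(\<lambda>n. f n / real n) \<longlonglongrightarrow> L"
  proof (rule order_tendstoI)
    fix a assume "a < L"
    show "eventually (\<lambda>n. a < f n / real n) sequentially"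
      using eventually_ge_at_top[of 1]
      by eventually_elim (use lower \<open>a < L\<close> in \<open>auto intro: less_le_trans\<close>)
  qed (rule upper)
  moreover have "real n * L \<le> f n" for n
    using lower[of n] nonneg[of n] by (cases "n = 0") (auto simp: field_simps)
  ultimately show thesis by (rule that)
qed

section \<open>Languages and entropy\<close>

lemma lang_iff: "w \<in> lang Y \<longleftrightarrow> (\<exists>x\<in>Y. occurs_in w x)"
  by (auto simp: lang_def lang_n_def)

lemma lang_n_iff: "w \<in> lang_n n Y \<longleftrightarrow> w \<in> lang Y \<and> length w = n"
  by (auto simp: lang_def lang_n_def)

lemma finite_lang_n [simp]: "finite (lang_n n (Y :: (int \<Rightarrow> 'a::finite) set))"
  by (rule finite_subset[OF _ finite_lists_length_eq[of UNIV n]]) (auto simp: lang_n_def)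

lemma lang_mono: "Z \<subseteq> Y \<Longrightarrow> lang Z \<subseteq> lang Y"
  by (fastforce simp: lang_iff)

lemma occurs_in_append:
  assumes "occurs_in (u @ v) x"
  shows "occurs_in u x" and "occurs_in v x"
proof -
  obtain i where i: "\<And>k. k < length (u @ v) \<Longrightarrow> x (i + int k) = (u @ v) ! k"
    using assms by (auto simp: occurs_in_def)
  have "x (i + int k) = u ! k" if "k < length u" for k
    using i[of k] that by (simp add: nth_append)
  then show "occurs_in u x" unfolding occurs_in_def by blast
  have "x (i + int (length u) + int k) = v ! k" if "k < length v" for k
    using i[of "length u + k"] that by (simp add: nth_append add.assoc)
  then show "occurs_in v x" unfolding occurs_in_def by blast
qed

lemma lang_append:
  assumes "u @ v \<in> lang Y"
  shows "u \<in> lang Y" and "v \<in> lang Y"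
  using assms occurs_in_append[of u v] unfolding lang_iff by blast+

lemma occurs_in_extend:
  assumes "occurs_in u x"
  shows "\<exists>w. length w = n \<and> occurs_in (u @ w) x"
proof -
  obtain i where i: "\<And>k. k < length u \<Longrightarrow> x (i + int k) = u ! k"
    using assms by (auto simp: occurs_in_def)
  define w where "w = map (\<lambda>k. x (i + int (length u + k))) [0..<n]"
  have "x (i + int k) = (u @ w) ! k" if "k < length (u @ w)" for k
    using i that by (auto simp: nth_append w_def)
  then have "occurs_in (u @ w) x" unfolding occurs_in_def by blast
  then show ?thesis by (intro exI[of _ w]) (simp add: w_def)
qed

lemma lang_extend:
  assumes "u \<in> lang Y"
  obtains w where "length w = n" and "u @ w \<in> lang Y"
  using assms occurs_in_extend[of u _ n] unfolding lang_iff by blast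

lemma Nil_in_lang: "Y \<noteq> {} \<Longrightarrow> [] \<in> lang Y"
  by (auto simp: lang_iff occurs_in_def)

lemma card_lang_n_pos:
  fixes Y :: "(int \<Rightarrow> 'a::finite) set"
  assumes "Y \<noteq> {}"
  shows "card (lang_n n Y) > 0"
proof -
  obtain w where "length w = n" "[] @ w \<in> lang Y"
    using lang_extend[OF Nil_in_lang[OF assms]] .
  then have "w \<in> lang_n n Y" by (simp add: lang_n_iff)
  then show ?thesis by (auto simp: card_gt_0_iff)
qed

lemma card_lang_n_add_le:
  fixes Y :: "(int \<Rightarrow> 'a::finite) set"
  shows "card (lang_n (m + n) Y) \<le> card (lang_n m Y) * card (lang_n n Y)"
proof -
  have "lang_n (m + n) Y \<subseteq> (\<lambda>(u, v). u @ v) ` (lang_n m Y \<times> lang_n n Y)"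
  proof
    fix w assume "w \<in> lang_n (m + n) Y"
    then have w: "w \<in> lang Y" "length w = m + n" by (auto simp: lang_n_iff)
    then have "take m w \<in> lang_n m Y" "drop m w \<in> lang_n n Y"
      using lang_append[of "take m w" "drop m w" Y] by (auto simp: lang_n_iff)
    then show "w \<in> (\<lambda>(u, v). u @ v) ` (lang_n m Y \<times> lang_n n Y)"
      by (intro image_eqI[of _ _ "(take m w, drop m w)"]) auto
  qed
  then have "card (lang_n (m + n) Y) \<le> card (lang_n m Y \<times> lang_n n Y)"
    by (rule surj_card_le[rotated]) simp
  then show ?thesis by (simp add: card_cartesian_product)
qed

text \<open>
  The logarithmic word counts are subadditive, because a word of length \<open>m + n\<close> is determined by its
  prefix of length \<open>m\<close> and its suffix of length \<open>n\<close>. So the limit defining the entropy exists, and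
  every word count gives an upper bound for it.
\<close>

lemma h_top_growth:
  fixes Y :: "(int \<Rightarrow> 'a::finite) set"
  assumes "Y \<noteq> {}"
  shows h_top_tendsto: "(\<lambda>n. ln (real (card (lang_n n Y))) / real n) \<longlonglongrightarrow> h_top Y"
    and h_top_le: "real n * h_top Y \<le> ln (real (card (lang_n n Y)))"
    and h_top_nonneg: "0 \<le> h_top Y"
proof -
  let ?f = "\<lambda>n. ln (real (card (lang_n n Y)))"
  note pos = card_lang_n_pos[OF assms]
  have nonneg: "0 \<le> ?f n" for n using pos[of n] by (simp add: Suc_le_eq)
  moreover have "?f (m + n) \<le> ?f m + ?f n" for m n
  proof -
    have "?f (m + n) \<le> ln (real (card (lang_n m Y)) * real (card (lang_n n Y)))"
      using card_lang_n_add_le[of m n Y] pos[of "m + n"] pos[of m] pos[of n]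
      by (subst ln_le_cancel_iff) (auto simp flip: of_nat_mult)
    also have "\<dots> = ?f m + ?f n" using pos[of m] pos[of n] by (intro ln_mult_pos) simp_all
    finally show ?thesis .
  qed
  ultimately obtain L where L: "(\<lambda>n. ?f n / real n) \<longlonglongrightarrow> L" "\<And>n. real n * L \<le> ?f n"
    using subadditive_growth_rate[of ?f] by blast
  have "h_top Y = L" unfolding h_top_def using L(1) by (rule limI)
  with L show "(\<lambda>n. ?f n / real n) \<longlonglongrightarrow> h_top Y" "real n * h_top Y \<le> ?f n" by auto
  then show "0 \<le> h_top Y"
    by (intro tendsto_lowerbound[of "\<lambda>n. ?f n / real n" "h_top Y" sequentially])
      (auto intro!: always_eventually divide_nonneg_nonneg nonneg simp del: ln_ge_zero_iff)
qed

section \<open>Weighted counting of right extensions\<close>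

definition followers :: "(int \<Rightarrow> 'a) set \<Rightarrow> nat \<Rightarrow> 'a list \<Rightarrow> 'a list set" where
  "followers Y n u = {w. length w = n \<and> u @ w \<in> lang Y}"

text \<open>
  The generating function of the continuations of a word, evaluated at \<open>1 / \<mu>\<close>. In matrix terms it is
  the vector \<open>(1 - A / \<mu>)\<^sup>-\<^sup>1 1\<close> for the transition matrix \<open>A\<close>; it takes the place of a
  Perron eigenvector, whose existence would need a separate argument.
\<close>

definition extension_weight :: "(int \<Rightarrow> 'a) set \<Rightarrow> real \<Rightarrow> 'a list \<Rightarrow> real" where
  "extension_weight Y \<mu> u = (\<Sum>n. real (card (followers Y n u)) / \<mu> ^ n)"

lemma followers_subset_lang_n: "followers Y n u \<subseteq> lang_n n Y"
  using lang_append by (auto simp: followers_def lang_n_iff)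

lemma finite_followers [simp]: "finite (followers (Y :: (int \<Rightarrow> 'a::finite) set) n u)"
  by (rule finite_subset[OF followers_subset_lang_n finite_lang_n])

lemma lang_n_eq_followers: "lang_n n Y = followers Y n []"
  by (auto simp: followers_def lang_n_iff)

text \<open>
  A continuation by \<open>k + n\<close> letters is one by \<open>k\<close> letters followed by one by \<open>n\<close> letters. For \<open>u = []\<close>
  this decomposes the words of length \<open>k + n\<close> themselves.
\<close>

lemma sum_followers_add:
  fixes Y :: "(int \<Rightarrow> 'a::finite) set"
  shows "(\<Sum>w\<in>followers Y (k + n) u. g w)
       = (\<Sum>w\<in>followers Y k u. \<Sum>v\<in>followers Y n (u @ w). g (w @ v))"
proof -
  have "(\<Sum>w\<in>followers Y k u. \<Sum>v\<in>followers Y n (u @ w). g (w @ v))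
      = (\<Sum>(w, v)\<in>Sigma (followers Y k u) (\<lambda>w. followers Y n (u @ w)). g (w @ v))"
    by (rule sum.Sigma) auto
  also have "\<dots> = (\<Sum>w\<in>followers Y (k + n) u. g w)"
  proof (rule sum.reindex_bij_witness[of _ "\<lambda>z. (take k z, drop k z)" "\<lambda>(w, v). w @ v"])
    fix z assume "z \<in> followers Y (k + n) u"
    then have z: "length z = k + n" "(u @ take k z) @ drop k z \<in> lang Y"
      by (auto simp: followers_def)
    then show "(take k z, drop k z) \<in> Sigma (followers Y k u) (\<lambda>w. followers Y n (u @ w))"
      using lang_append(1)[OF z(2)] by (auto simp: followers_def)
  qed (auto simp: followers_def)
  finally show ?thesis ..
qed

lemma summable_followers:
  fixes Y :: "(int \<Rightarrow> 'a::finite) set"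
  assumes "Y \<noteq> {}" and "exp (h_top Y) < \<mu>"
  shows "summable (\<lambda>n. real (card (followers Y n u)) / \<mu> ^ n)"
proof -
  obtain \<rho> where \<rho>: "exp (h_top Y) < \<rho>" "\<rho> < \<mu>" using dense[OF assms(2)] by blast
  have pos: "\<rho> > 0" using \<rho>(1) exp_gt_zero[of "h_top Y"] by linarith
  then have "h_top Y < ln \<rho>" using \<rho>(1) by (metis exp_gt_zero ln_exp ln_less_cancel_iff)
  then have "eventually (\<lambda>n. ln (real (card (lang_n n Y))) / real n < ln \<rho>) sequentially"
    using order_tendstoD(2)[OF h_top_tendsto[OF assms(1)]] by blast
  then have "eventually (\<lambda>n. norm (real (card (followers Y n u)) / \<mu> ^ n) \<le> (\<rho> / \<mu>) ^ n)
      sequentially"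
    using eventually_ge_at_top[of 1]
  proof eventually_elim
    case (elim n)
    have "ln (real (card (lang_n n Y))) \<le> real n * ln \<rho>" using elim by (simp add: field_simps)
    also have "\<dots> = ln (\<rho> ^ n)" using pos by (simp add: ln_realpow)
    finally have "real (card (lang_n n Y)) \<le> \<rho> ^ n"
      using card_lang_n_pos[OF assms(1), of n] pos by simp
    moreover have "card (followers Y n u) \<le> card (lang_n n Y)"
      by (intro card_mono followers_subset_lang_n) simp
    ultimately have "real (card (followers Y n u)) \<le> \<rho> ^ n" by linarith
    then show ?case using pos \<rho>(2) by (simp add: power_divide divide_right_mono)
  qed
  then show ?thesis
    by (rule summable_comparison_test_ev) (use pos \<rho> in \<open>auto intro: summable_geometric\<close>)
qed

lemma extension_weight_ge_1:
  fixes Y :: "(int \<Rightarrow> 'a::finite) set"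
  assumes "Y \<noteq> {}" and "exp (h_top Y) < \<mu>" and "u \<in> lang Y"
  shows "1 \<le> extension_weight Y \<mu> u"
proof -
  have \<mu>: "\<mu> > 0" using assms(2) exp_gt_zero[of "h_top Y"] by linarith
  have "followers Y 0 u = {[]}" using assms(3) by (auto simp: followers_def)
  then have "1 = (\<Sum>n<1. real (card (followers Y n u)) / \<mu> ^ n)" by simp
  also have "\<dots> \<le> extension_weight Y \<mu> u"
    unfolding extension_weight_def
    by (intro sum_le_suminf summable_followers assms) (use \<mu> in auto)
  finally show ?thesis .
qed

lemma extension_weight_nonneg:
  fixes Y :: "(int \<Rightarrow> 'a::finite) set"
  assumes "Y \<noteq> {}" and "exp (h_top Y) < \<mu>"
  shows "0 \<le> extension_weight Y \<mu> u"
  unfolding extension_weight_def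
  by (intro suminf_nonneg summable_followers assms)
     (use less_trans[OF exp_gt_zero assms(2)] in simp)

text \<open>
  Summing over the continuations by \<open>k\<close> letters shifts the series by \<open>k\<close> places: the sum equals
  \<open>\<mu> ^ k\<close> times the tail of the series that starts at index \<open>k\<close>.
\<close>

lemma sum_extension_weight_le:
  fixes Y :: "(int \<Rightarrow> 'a::finite) set"
  assumes "Y \<noteq> {}" and "exp (h_top Y) < \<mu>"
  shows "(\<Sum>w\<in>followers Y k u. extension_weight Y \<mu> (u @ w)) \<le> \<mu> ^ k * extension_weight Y \<mu> u"
proof -
  have \<mu>: "\<mu> > 0" using assms(2) exp_gt_zero[of "h_top Y"] by linarith
  let ?F = "\<lambda>n. real (card (followers Y n u)) / \<mu> ^ n"
  note summ = summable_followers[OF assms]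
  have "(\<Sum>w\<in>followers Y k u. extension_weight Y \<mu> (u @ w))
      = (\<Sum>n. \<Sum>w\<in>followers Y k u. real (card (followers Y n (u @ w))) / \<mu> ^ n)"
    unfolding extension_weight_def by (rule suminf_sum[symmetric]) (rule summ)
  also have "\<dots> = (\<Sum>n. \<mu> ^ k * ?F (n + k))"
  proof (rule suminf_cong)
    fix n
    have "card (followers Y (k + n) u) = (\<Sum>w\<in>followers Y k u. card (followers Y n (u @ w)))"
      using sum_followers_add[of "\<lambda>_. 1::nat" Y k n u] by simp
    then show "(\<Sum>w\<in>followers Y k u. real (card (followers Y n (u @ w))) / \<mu> ^ n)
        = \<mu> ^ k * ?F (n + k)"
      using \<mu> by (simp add: power_add field_simps sum_divide_distrib[symmetric])
  qed
  also have "\<dots> = \<mu> ^ k * (\<Sum>n. ?F (n + k))"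
    by (rule suminf_mult) (rule summable_ignore_initial_segment[OF summ])
  also have "(\<Sum>n. ?F (n + k)) = suminf ?F - (\<Sum>n<k. ?F n)"
    by (rule suminf_minus_initial_segment[OF summ])
  also have "\<dots> \<le> suminf ?F" using \<mu> by (simp add: sum_nonneg)
  finally show ?thesis using \<mu> by (simp add: extension_weight_def)
qed

lemma extension_weight_append_le:
  fixes Y :: "(int \<Rightarrow> 'a::finite) set"
  assumes "Y \<noteq> {}" and "exp (h_top Y) < \<mu>" and "u @ w \<in> lang Y"
  shows "extension_weight Y \<mu> (u @ w) \<le> \<mu> ^ length w * extension_weight Y \<mu> u"
proof -
  have "w \<in> followers Y (length w) u" using assms(3) by (simp add: followers_def)
  then have "extension_weight Y \<mu> (u @ w)
      \<le> (\<Sum>v\<in>followers Y (length w) u. extension_weight Y \<mu> (u @ v))"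
    by (rule member_le_sum) (simp_all add: extension_weight_nonneg[OF assms(1,2)])
  then show ?thesis using sum_extension_weight_le[OF assms(1,2)] by (rule order_trans)
qed

section \<open>Irreducible Markov shifts\<close>

text \<open>
  Only two features of the covers enter the entropy estimate: the last \<open>m\<close> letters of a word determine
  its continuations, and any word of length \<open>m\<close> can be followed by any other. The states of
  the corresponding graph are the words of length \<open>m\<close>.
\<close>

locale irreducible_markov_shift =
  fixes Y :: "(int \<Rightarrow> 'a::finite) set" and m :: nat
  assumes nonempty: "Y \<noteq> {}"
    and memory_pos: "1 \<le> m"
    and glue: "\<And>x u w. x @ u \<in> lang Y \<Longrightarrow> u @ w \<in> lang Y \<Longrightarrow> length u = m \<Longrightarrow> x @ u @ w \<in> lang Y"
    and connected: "\<And>u v. u \<in> lang_n m Y \<Longrightarrow> v \<in> lang_n m Y \<Longrightarrow> \<exists>w. u @ w @ v \<in> lang Y"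
begin

abbreviation num_states :: nat where "num_states \<equiv> card (lang_n m Y)"

lemma num_states_pos: "num_states \<ge> 1"
  using card_lang_n_pos[OF nonempty, of m] by simp

text \<open>
  Continuing \<open>u\<close> letter by letter is a walk on the words of length \<open>m\<close>, given by the window that
  moves one letter to the right. A reachable vertex of a finite graph is reachable in at most as many
  steps as there are edges, hence in at most \<open>s\<^sup>2\<close> steps. The word \<open>v\<close> may overlap \<open>u\<close>, so the conclusion
  only says that \<open>v\<close> is a suffix of the extended word.
\<close>

lemma short_connection:
  assumes "u \<in> lang_n m Y" and "v \<in> lang_n m Y"
  obtains w x where "length w \<le> num_states\<^sup>2" and "u @ w \<in> lang Y" and "u @ w = x @ v"
proof -
  define R where "R = {(p, q) \<in> lang_n m Y \<times> lang_n m Y.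
                        \<exists>a. p @ [a] \<in> lang Y \<and> q = tl p @ [a]}"
  have R_sub: "R \<subseteq> lang_n m Y \<times> lang_n m Y" by (auto simp: R_def)
  then have finR: "finite R" by (rule finite_subset) simp
  have "card R \<le> card (lang_n m Y \<times> lang_n m Y)" by (rule card_mono[OF _ R_sub]) simp
  then have cardR: "card R \<le> num_states\<^sup>2"
    by (simp add: card_cartesian_product power2_eq_square)
  have word_to_path: "(u, drop (length w) (u @ w)) \<in> R ^^ length w" if "u @ w \<in> lang Y" for w
    using that
  proof (induction w rule: rev_induct)
    case (snoc a w)
    have len: "length u = m" using assms(1) by (simp add: lang_n_iff)
    define p where "p = drop (length w) (u @ w)"
    have uw: "u @ w = take (length w) (u @ w) @ p" unfolding p_def by (rule append_take_drop_id[symmetric])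
    have pl: "length p = m" by (simp add: p_def len)
    have uwa: "u @ w @ [a] = take (length w) (u @ w) @ (p @ [a])"
      using uw by (metis append.assoc)
    have pa: "p @ [a] \<in> lang Y" using snoc.prems uwa lang_append(2) by metis
    have pne: "p \<noteq> []" using pl memory_pos by auto
    then have pa_tl: "p @ [a] = [hd p] @ (tl p @ [a])" by simp
    then have "tl p @ [a] \<in> lang Y" using pa lang_append(2) by metis
    moreover have "p \<in> lang Y" using pa lang_append(1) by blast
    ultimately have "(p, tl p @ [a]) \<in> R"
      using pa pl memory_pos by (auto simp: R_def lang_n_iff)
    moreover have "(u, p) \<in> R ^^ length w"
      unfolding p_def using snoc.IH snoc.prems lang_append(1)[of "u @ w" "[a]" Y] by simp
    moreover have "tl p @ [a] = drop (length (w @ [a])) (u @ w @ [a])"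
    proof -
      have "length (take (length w) (u @ w)) = length w" by simp
      then have "drop (length (w @ [a])) (take (length w) (u @ w) @ (p @ [a])) = drop 1 (p @ [a])"
        by (simp del: take_append)
      also have "\<dots> = tl p @ [a]" using pne by (cases p) auto
      finally show ?thesis unfolding uwa ..
    qed
    ultimately show ?case by auto
  qed simp
  have path_to_word: "\<exists>w. length w = n \<and> u @ w \<in> lang Y \<and> drop n (u @ w) = q"
    if "(u, q) \<in> R ^^ n" for n q
    using that
  proof (induction n arbitrary: q)
    case 0
    then show ?case using assms(1) by (auto simp: lang_n_iff)
  next
    case (Suc n)
    then obtain p where p: "(u, p) \<in> R ^^ n" "(p, q) \<in> R" by auto
    from Suc.IH[OF p(1)] obtain w where
      w: "length w = n" "u @ w \<in> lang Y" "drop n (u @ w) = p" by blast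
    from p(2) obtain a where a: "p @ [a] \<in> lang Y" "q = tl p @ [a]" and lp: "length p = m"
      by (auto simp: R_def lang_n_iff)
    have uw: "u @ w = take n (u @ w) @ p" using w(3) by (metis append_take_drop_id)
    then have "take n (u @ w) @ p @ [a] \<in> lang Y" using glue[OF _ a(1) lp] w(2) by metis
    then have "u @ w @ [a] \<in> lang Y" using uw by (metis append.assoc)
    moreover have "drop (Suc n) (u @ w @ [a]) = q"
    proof -
      have "u @ w @ [a] = take n (u @ w) @ (p @ [a])" using uw by (metis append.assoc)
      moreover have "length (take n (u @ w)) = n" using w(1) by simp
      ultimately have "drop n (u @ w @ [a]) = p @ [a]" by (metis append_eq_conv_conj)
      moreover have "drop (Suc n) (u @ w @ [a]) = tl (drop n (u @ w @ [a]))"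
        by (simp only: drop_Suc tl_drop)
      ultimately have "drop (Suc n) (u @ w @ [a]) = tl (p @ [a])" by simp
      moreover have "p \<noteq> []" using lp memory_pos by auto
      ultimately show ?thesis using a(2) by simp
    qed
    ultimately show ?case using w(1) by (intro exI[of _ "w @ [a]"]) simp
  qed
  obtain w where w: "u @ w @ v \<in> lang Y" using connected[OF assms] by blast
  have len: "length u = m" "length v = m" using assms by (auto simp: lang_n_iff)
  have "drop (length (w @ v)) (u @ w @ v) = v" using len by simp
  then have "(u, v) \<in> R ^^ length (w @ v)" using word_to_path[OF w] by simp
  then have "(u, v) \<in> R\<^sup>*" by (rule relpow_imp_rtrancl)
  then obtain n where n: "n \<le> card R" "(u, v) \<in> R ^^ n"
    using rtrancl_finite_eq_relpow[OF finR] by auto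
  from path_to_word[OF n(2)] obtain w' where
    w': "length w' = n" "u @ w' \<in> lang Y" "drop n (u @ w') = v" by blast
  have "length w' \<le> num_states\<^sup>2" using n(1) cardR w'(1) by simp
  moreover have "u @ w' = take n (u @ w') @ v" using w'(3) by (metis append_take_drop_id)
  ultimately show thesis using that w'(2) by blast
qed

lemma followers_suffix:
  assumes "x @ u \<in> lang Y" and "length u = m"
  shows "followers Y n (x @ u) = followers Y n u"
  using assms glue[of x u] lang_append(2)[of x] by (auto simp: followers_def)

lemma extension_weight_suffix:
  assumes "x @ u \<in> lang Y" and "length u = m"
  shows "extension_weight Y \<mu> (x @ u) = extension_weight Y \<mu> u"
  by (simp add: extension_weight_def followers_suffix[OF assms])

text \<open>
  The continuation first leads from the last window of \<open>u\<close> to the first window of \<open>P\<close> (at most \<open>s\<^sup>2\<close>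
  letters), completes \<open>P\<close> (at most \<open>j\<close> letters), and is padded to length \<open>s\<^sup>2 + j\<close>. It is
  heavy because at most \<open>s\<^sup>2\<close> further letters restore the last window of \<open>u\<close>: the weight depends
  on that window only, and appending a letter raises it by a factor of at most \<open>\<mu>\<close>.
\<close>

lemma heavy_follower_containing:
  assumes \<mu>: "exp (h_top Y) < \<mu>"
    and P: "P \<in> lang Y" "m \<le> length P" "length P \<le> m + j"
    and u: "u \<in> lang Y" "m \<le> length u"
  obtains w where "w \<in> followers Y (num_states\<^sup>2 + j) u"
    and "\<exists>a b. u @ w = a @ P @ b"
    and "extension_weight Y \<mu> u \<le> \<mu> ^ num_states\<^sup>2 * extension_weight Y \<mu> (u @ w)"
proof -
  let ?s = num_states
  have \<mu>1: "1 \<le> \<mu>" using \<mu> h_top_nonneg[OF nonempty] one_le_exp_iff[of "h_top Y"] by linarith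
  \<comment> \<open>\<open>u'\<close> is the last window of \<open>u\<close>, and \<open>p\<close> is the first window of \<open>P\<close>.\<close>
  define x u' where "x = take (length u - m) u" and "u' = drop (length u - m) u"
  have xu: "u = x @ u'" and lu': "length u' = m" using u(2) by (auto simp: x_def u'_def)
  have u': "u' \<in> lang_n m Y" using u(1) xu lu' lang_append(2) by (auto simp: lang_n_iff)
  define p q where "p = take m P" and "q = drop m P"
  have P_eq: "P = p @ q" and lp: "length p = m" and lq: "length q \<le> j"
    using P(2,3) by (auto simp: p_def q_def)
  have p: "p \<in> lang_n m Y" using P(1) P_eq lp lang_append(1) by (auto simp: lang_n_iff)
  obtain w1 x1 where w1: "length w1 \<le> ?s\<^sup>2" "u' @ w1 \<in> lang Y" "u' @ w1 = x1 @ p"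
    using short_connection[OF u' p] .
  have "x1 @ p @ q \<in> lang Y" using glue[of x1 p q] w1 P(1) P_eq lp by auto
  then have "u' @ w1 @ q \<in> lang Y" using w1(3) by (metis append.assoc)
  then obtain e where e: "length e = ?s\<^sup>2 + j - length (w1 @ q)" "(u' @ w1 @ q) @ e \<in> lang Y"
    by (rule lang_extend)
  define w where "w = w1 @ q @ e"
  have lw: "length w = ?s\<^sup>2 + j" using e(1) w1(1) lq by (simp add: w_def)
  have u'w: "u' @ w \<in> lang Y" using e(2) by (simp add: w_def)
  then have uw: "u @ w \<in> lang Y" using glue[of x u' w] u(1) xu lu' by simp
  have occ: "u @ w = (x @ x1) @ P @ e"
    using w1(3) by (simp add: w_def xu P_eq)
  \<comment> \<open>Return from the last window \<open>v\<close> of \<open>u @ w\<close> to the window \<open>u'\<close>.\<close>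
  define y v where "y = take (length (u @ w) - m) (u @ w)" and "v = drop (length (u @ w) - m) (u @ w)"
  have yv: "u @ w = y @ v" unfolding y_def v_def by (rule append_take_drop_id[symmetric])
  have lv: "length v = m" using u(2) by (simp add: v_def)
  have v: "v \<in> lang_n m Y" using uw yv lv lang_append(2) by (auto simp: lang_n_iff)
  obtain w2 x2 where w2: "length w2 \<le> ?s\<^sup>2" "v @ w2 \<in> lang Y" "v @ w2 = x2 @ u'"
    using short_connection[OF v u'] .
  have "y @ v @ w2 \<in> lang Y" using glue[of y v w2] uw yv w2(2) lv by simp
  then have uww: "(u @ w) @ w2 \<in> lang Y" using yv by simp
  have uww_eq: "(u @ w) @ w2 = (y @ x2) @ u'" using yv w2(3) by simp
  have "extension_weight Y \<mu> u = extension_weight Y \<mu> u'"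
    using extension_weight_suffix[of x u'] u(1) xu lu' by simp
  also have "\<dots> = extension_weight Y \<mu> ((u @ w) @ w2)"
    using extension_weight_suffix[of "y @ x2" u'] uww uww_eq lu' by simp
  also have "\<dots> \<le> \<mu> ^ length w2 * extension_weight Y \<mu> (u @ w)"
    by (rule extension_weight_append_le[OF nonempty \<mu> uww])
  also have "\<dots> \<le> \<mu> ^ ?s\<^sup>2 * extension_weight Y \<mu> (u @ w)"
    using \<mu>1 w2(1) by (intro mult_right_mono power_increasing extension_weight_nonneg[OF nonempty \<mu>]) auto
  finally have weight:
    "extension_weight Y \<mu> u \<le> \<mu> ^ ?s\<^sup>2 * extension_weight Y \<mu> (u @ w)" .
  have "w \<in> followers Y (?s\<^sup>2 + j) u" using uw lw by (simp add: followers_def)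
  moreover have "\<exists>a b. u @ w = a @ P @ b" using occ by blast
  ultimately show thesis using weight by (rule that)
qed

lemma sum_extension_weight_avoiding_le:
  assumes \<mu>: "exp (h_top Y) < \<mu>"
    and P: "P \<in> lang Y" "m \<le> length P" "length P \<le> m + j"
    and Z: "Z \<subseteq> Y" "P \<notin> lang Z"
    and u: "u \<in> lang Y" "m \<le> length u"
  shows "(\<Sum>w\<in>followers Z (num_states\<^sup>2 + j) u. extension_weight Y \<mu> (u @ w))
       \<le> (\<mu> ^ (num_states\<^sup>2 + j) - 1 / \<mu> ^ num_states\<^sup>2) * extension_weight Y \<mu> u"
proof -
  let ?T = "num_states\<^sup>2 + j" and ?f = "extension_weight Y \<mu>"
  have \<mu>0: "0 < \<mu>" using \<mu> exp_gt_zero[of "h_top Y"] by linarith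
  obtain w where w: "w \<in> followers Y ?T u" "\<exists>a b. u @ w = a @ P @ b"
      "?f u \<le> \<mu> ^ num_states\<^sup>2 * ?f (u @ w)"
    using heavy_follower_containing[OF \<mu> P u] .
  have "u @ w \<notin> lang Z"
  proof
    assume "u @ w \<in> lang Z"
    moreover obtain a b where "u @ w = a @ P @ b" using w(2) by blast
    ultimately have "P \<in> lang Z" using lang_append(2)[of a "P @ b"] lang_append(1)[of P b] by simp
    then show False using Z(2) by simp
  qed
  then have sub: "followers Z ?T u \<subseteq> followers Y ?T u - {w}"
    using lang_mono[OF Z(1)] by (auto simp: followers_def)
  have "(\<Sum>v\<in>followers Z ?T u. ?f (u @ v)) \<le> (\<Sum>v\<in>followers Y ?T u - {w}. ?f (u @ v))"
    by (rule sum_mono2[OF _ sub]) (auto simp: extension_weight_nonneg[OF nonempty \<mu>])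
  also have "\<dots> = (\<Sum>v\<in>followers Y ?T u. ?f (u @ v)) - ?f (u @ w)"
    using w(1) by (simp add: sum_diff1)
  also have "\<dots> \<le> \<mu> ^ ?T * ?f u - ?f u / \<mu> ^ num_states\<^sup>2"
  proof (rule diff_mono)
    show "(\<Sum>v\<in>followers Y ?T u. ?f (u @ v)) \<le> \<mu> ^ ?T * ?f u"
      by (rule sum_extension_weight_le[OF nonempty \<mu>])
    show "?f u / \<mu> ^ num_states\<^sup>2 \<le> ?f (u @ w)"
      using w(3) \<mu>0 by (simp add: divide_le_eq mult.commute)
  qed
  finally show ?thesis by (simp add: algebra_simps)
qed

text \<open>
  Weights are at least 1, so the total weight bounds the number of words, and the total weight of the
  words of \<open>Z\<close> gains at most the factor \<open>K\<close> with every \<open>T\<close> letters.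
\<close>

lemma growth_of_avoiding_words:
  assumes \<mu>: "exp (h_top Y) < \<mu>"
    and P: "P \<in> lang Y" "m \<le> length P" "length P \<le> m + j"
    and Z: "Z \<subseteq> Y" "P \<notin> lang Z"
  defines "T \<equiv> num_states\<^sup>2 + j"
  defines "K \<equiv> \<mu> ^ T - 1 / \<mu> ^ num_states\<^sup>2"
  shows "real (card (lang_n (m + q * T) Z)) \<le> K ^ q * (\<Sum>u\<in>lang_n m Z. extension_weight Y \<mu> u)"
proof -
  let ?f = "extension_weight Y \<mu>"
  define W where "W n = (\<Sum>u\<in>lang_n n Z. ?f u)" for n
  have \<mu>1: "1 \<le> \<mu>" using \<mu> h_top_nonneg[OF nonempty] one_le_exp_iff[of "h_top Y"] by linarith
  have in_Y: "u \<in> lang Y" if "u \<in> lang_n n Z" for u n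
    using that lang_mono[OF Z(1)] by (auto simp: lang_n_iff)
  have "1 / \<mu> ^ num_states\<^sup>2 \<le> 1" "1 \<le> \<mu> ^ T"
    using \<mu>1 by (auto simp: one_le_power)
  then have K0: "0 \<le> K" by (simp add: K_def)
  have step: "W (n + T) \<le> K * W n" if n: "m \<le> n" for n
  proof -
    have "W (n + T) = (\<Sum>u\<in>lang_n n Z. \<Sum>w\<in>followers Z T u. ?f (u @ w))"
      unfolding W_def lang_n_eq_followers
      using sum_followers_add[of ?f Z n T "[]"] by simp
    also have "\<dots> \<le> (\<Sum>u\<in>lang_n n Z. K * ?f u)"
      unfolding T_def K_def
      by (intro sum_mono sum_extension_weight_avoiding_le[OF \<mu> P Z])
        (use in_Y n in \<open>auto simp: lang_n_iff\<close>)
    finally show ?thesis by (simp add: W_def sum_distrib_left)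
  qed
  have iterate: "W (m + q * T) \<le> K ^ q * W m" for q
  proof (induction q)
    case (Suc q)
    have "W (m + Suc q * T) \<le> K * W (m + q * T)"
      using step[of "m + q * T"] by (simp add: algebra_simps)
    also have "\<dots> \<le> K * (K ^ q * W m)" by (rule mult_left_mono[OF Suc K0])
    finally show ?case by simp
  qed simp
  have "real (card (lang_n (m + q * T) Z)) = (\<Sum>u\<in>lang_n (m + q * T) Z. 1)" by simp
  also have "\<dots> \<le> W (m + q * T)"
    unfolding W_def by (intro sum_mono extension_weight_ge_1[OF nonempty \<mu>] in_Y)
  also note iterate[of q]
  finally show ?thesis by (simp add: W_def)
qed

text \<open>
  Counting words of \<open>Z\<close> gives \<open>T h(Z) \<le> ln K\<close> for every \<open>\<mu> = exp t\<close> with \<open>t > h(Y)\<close>. Since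
  \<open>K = \<mu> ^ T (1 - \<mu> ^ (- (s\<^sup>2 + T)))\<close> and \<open>ln (1 - a) \<le> - a\<close>, the loss persists as \<open>t\<close> decreases to \<open>h(Y)\<close>;
  the bound \<open>exp (h(Y)) \<le> s\<close> then makes it explicit.
\<close>

theorem entropy_gap:
  assumes P: "P \<in> lang Y" "m \<le> length P" "length P \<le> m + j"
    and Z: "Z \<noteq> {}" "Z \<subseteq> Y" "P \<notin> lang Z"
  shows "h_top Z + 1 / (real (num_states\<^sup>2 + j) * real num_states ^ (2 * num_states\<^sup>2 + j))
       \<le> h_top Y"
proof -
  let ?s = num_states
  define T where "T = ?s\<^sup>2 + j"
  have T: "T > 0" using num_states_pos by (simp add: T_def)
  have above: "real T * h_top Z \<le> real T * t - exp (- (real (?s\<^sup>2 + T) * t))" if t: "h_top Y < t" for t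
  proof -
    define \<mu> where "\<mu> = exp t"
    define K where "K = \<mu> ^ T - 1 / \<mu> ^ ?s\<^sup>2"
    define W where "W = (\<Sum>u\<in>lang_n m Z. extension_weight Y \<mu> u)"
    have \<mu>: "exp (h_top Y) < \<mu>" using t by (simp add: \<mu>_def)
    have count: "real (card (lang_n (m + q * T) Z)) \<le> K ^ q * W" for q
      unfolding K_def W_def T_def by (rule growth_of_avoiding_words[OF \<mu> P Z(2,3)])
    have "0 < t" using t h_top_nonneg[OF nonempty] by linarith
    have \<mu>1: "1 < \<mu>" using \<open>0 < t\<close> by (simp add: \<mu>_def)
    have "1 / \<mu> ^ ?s\<^sup>2 \<le> 1" "1 < \<mu> ^ T"
      using \<mu>1 T by (auto intro: one_less_power simp: one_le_power)
    then have K: "K > 0" by (simp add: K_def)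
    have "0 < card (lang_n m Z)" by (rule card_lang_n_pos[OF Z(1)])
    then have W: "W > 0" using count[of 0] by simp
    \<comment> \<open>The right-hand side does not depend on \<open>q\<close>, so the factor of \<open>q\<close> cannot be positive.\<close>
    have linear: "real q * (real T * h_top Z - ln K) \<le> ln W - real m * h_top Z" for q
    proof -
      have "real (m + q * T) * h_top Z \<le> ln (real (card (lang_n (m + q * T) Z)))"
        by (rule h_top_le[OF Z(1)])
      also have "\<dots> \<le> ln (K ^ q * W)"
        using count[of q] card_lang_n_pos[OF Z(1), of "m + q * T"] by (intro ln_mono) auto
      also have "\<dots> = real q * ln K + ln W" using K W by (simp add: ln_mult ln_realpow)
      finally show ?thesis by (simp add: algebra_simps)
    qed
    have "real T * h_top Z \<le> ln K"
    proof (rule ccontr)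
      assume "\<not> ?thesis"
      then obtain q where "ln W - real m * h_top Z < real q * (real T * h_top Z - ln K)"
        using reals_Archimedean3[of "real T * h_top Z - ln K"] by auto
      with linear[of q] show False by simp
    qed
    also have "K = \<mu> ^ T * (1 - exp (- (real (?s\<^sup>2 + T) * t)))"
    proof -
      have "\<mu> ^ n = exp (real n * t)" for n by (simp add: \<mu>_def exp_of_nat_mult)
      then show ?thesis
        by (simp add: K_def algebra_simps exp_minus flip: exp_add) (simp add: exp_add exp_minus field_simps)
    qed
    also have "ln \<dots> = real T * t + ln (1 - exp (- (real (?s\<^sup>2 + T) * t)))"
    proof -
      have "0 < ?s\<^sup>2 + T" using T by simp
      then have "0 < real (?s\<^sup>2 + T) * t" using \<open>0 < t\<close> by (simp only: of_nat_0_less_iff mult_pos_pos)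
      then show ?thesis by (subst ln_mult_pos) (auto simp: \<mu>_def ln_realpow simp del: of_nat_add)
    qed
    also have "ln (1 - exp (- (real (?s\<^sup>2 + T) * t))) \<le> - exp (- (real (?s\<^sup>2 + T) * t))"
    proof -
      have "0 < ?s\<^sup>2 + T" using T by simp
      then have "0 < real (?s\<^sup>2 + T) * t" using \<open>0 < t\<close> by (simp only: of_nat_0_less_iff mult_pos_pos)
      then show ?thesis
        using ln_le_minus_one[of "1 - exp (- (real (?s\<^sup>2 + T) * t))"] by (simp del: of_nat_add)
    qed
    finally show ?thesis by simp
  qed
  let ?g = "\<lambda>t. real T * t - exp (- (real (?s\<^sup>2 + T) * t))"
  have "real T * h_top Z \<le> ?g (h_top Y)"
  proof (rule tendsto_lowerbound)
    show "(?g \<longlongrightarrow> ?g (h_top Y)) (at_right (h_top Y))" by (intro tendsto_intros)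
    show "eventually (\<lambda>t. real T * h_top Z \<le> ?g t) (at_right (h_top Y))"
      using eventually_at_right_less by (rule eventually_mono) (rule above)
  qed simp
  moreover have "1 / real ?s ^ (?s\<^sup>2 + T) \<le> exp (- (real (?s\<^sup>2 + T) * h_top Y))"
  proof -
    have "h_top Y \<le> real m * h_top Y"
      using mult_right_mono[of 1 "real m" "h_top Y"] h_top_nonneg[OF nonempty] memory_pos by simp
    also have "\<dots> \<le> ln (real ?s)" by (rule h_top_le[OF nonempty])
    finally have "exp (h_top Y) \<le> real ?s"
      using num_states_pos by (metis exp_le_cancel_iff exp_ln of_nat_0_less_iff less_le_trans zero_less_one)
    then have "exp (h_top Y) ^ (?s\<^sup>2 + T) \<le> real ?s ^ (?s\<^sup>2 + T)" by (rule power_mono) simp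
    moreover have "exp (h_top Y) ^ (?s\<^sup>2 + T) = exp (real (?s\<^sup>2 + T) * h_top Y)"
      by (rule exp_of_nat_mult[symmetric])
    ultimately have "1 / real ?s ^ (?s\<^sup>2 + T) \<le> 1 / exp (real (?s\<^sup>2 + T) * h_top Y)"
      by (intro divide_left_mono) (use num_states_pos in auto)
    then show ?thesis by (simp add: exp_minus inverse_eq_divide)
  qed
  ultimately have "real T * h_top Z + 1 / real ?s ^ (?s\<^sup>2 + T) \<le> real T * h_top Y" by linarith
  then have "(real T * h_top Z + 1 / real ?s ^ (?s\<^sup>2 + T)) / real T \<le> h_top Y"
    using T by (simp add: field_simps)
  moreover have "(real T * h_top Z + 1 / real ?s ^ (?s\<^sup>2 + T)) / real T
      = h_top Z + 1 / (real T * real ?s ^ (?s\<^sup>2 + T))"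
    using T by (simp add: add_divide_distrib)
  moreover have "?s\<^sup>2 + T = 2 * ?s\<^sup>2 + j" by (simp add: T_def)
  ultimately show ?thesis by (simp only: T_def)
qed

end

section \<open>The finite type cover of a transitive subshift\<close>

lemma sft_cover_antimono: "m \<le> n \<Longrightarrow> sft_cover X n \<subseteq> sft_cover X m"
  by (fastforce simp: sft_cover_def)

lemma subset_sft_cover: "X \<subseteq> sft_cover X m"
  by (auto simp: sft_cover_def lang_n_def)

lemma sft_cover_iff:
  "x \<in> sft_cover X m \<longleftrightarrow> (\<forall>w. 1 \<le> length w \<and> length w \<le> m \<and> occurs_in w x \<longrightarrow> w \<in> lang X)"
  by (force simp: sft_cover_def lang_n_iff)

text \<open>
  The cover of index \<open>m\<close> acquires no new words of length up to \<open>m\<close>.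
\<close>

lemma lang_sft_cover_short:
  assumes "X \<noteq> {}" and "w \<in> lang (sft_cover X m)" and "length w \<le> m"
  shows "w \<in> lang X"
proof (cases w)
  case Nil
  then show ?thesis using Nil_in_lang[OF assms(1)] by simp
next
  case (Cons a v)
  obtain x where "x \<in> sft_cover X m" "occurs_in w x" using assms(2) by (auto simp: lang_iff)
  then show ?thesis using assms(3) Cons by (simp add: sft_cover_iff)
qed

text \<open>
  Follow a point that contains \<open>x @ u\<close> up to the end of \<open>u\<close>, and from there a point that contains
  \<open>u @ w\<close>. The two points agree along \<open>u\<close>, so a window of length at most \<open>m\<close> lies entirely in one of them:
  if it reaches past the end of \<open>u\<close>, it starts no earlier than \<open>u\<close>.
\<close>

lemma sft_cover_glue:
  assumes "x @ u \<in> lang (sft_cover X m)" and "u @ w \<in> lang (sft_cover X m)" and "length u = m"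
  shows "x @ u @ w \<in> lang (sft_cover X m)"
proof -
  obtain y i where y: "y \<in> sft_cover X m" "\<And>k. k < length (x @ u) \<Longrightarrow> y (i + int k) = (x @ u) ! k"
    using assms(1) by (auto simp: lang_iff occurs_in_def)
  obtain z j where z: "z \<in> sft_cover X m" "\<And>k. k < length (u @ w) \<Longrightarrow> z (j + int k) = (u @ w) ! k"
    using assms(2) by (auto simp: lang_iff occurs_in_def)
  \<comment> \<open>\<open>e\<close> is the position just after \<open>u\<close> in \<open>y\<close>, and \<open>d\<close> moves the copy of \<open>u\<close> in \<open>y\<close> onto the one
     in \<open>z\<close>.\<close>
  define e where "e = i + int (length x) + int m"
  define d where "d = j - (i + int (length x))"
  define g where "g = (\<lambda>p. if p < e then y p else z (p + d))"
  have overlap: "y p = z (p + d)" if "e - int m \<le> p" "p < e" for p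
  proof -
    define k where "k = nat (p - (e - int m))"
    have k: "k < length u" "p = i + int (length x + k)" "p + d = j + int k"
      using that assms(3) by (auto simp: k_def e_def d_def)
    then have "y p = u ! k" using y(2)[of "length x + k"] by (simp add: nth_append)
    also have "u ! k = z (p + d)" unfolding k(3) using z(2)[of k] k(1) by (simp add: nth_append)
    finally show ?thesis .
  qed
  have right: "g p = z (p + d)" if "e - int m \<le> p" for p
    using overlap that by (auto simp: g_def)
  have "g \<in> sft_cover X m"
    unfolding sft_cover_iff
  proof (intro allI impI)
    fix v assume v: "1 \<le> length v \<and> length v \<le> m \<and> occurs_in v g"
    then obtain p where p: "\<And>k. k < length v \<Longrightarrow> g (p + int k) = v ! k"
      by (auto simp: occurs_in_def)
    show "v \<in> lang X"
    proof (cases "p + int (length v) \<le> e")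
      case True
      then have "y (p + int k) = v ! k" if "k < length v" for k
        using p[OF that] that by (simp add: g_def)
      then have "occurs_in v y" by (auto simp: occurs_in_def)
      then show ?thesis using y(1) v by (auto simp: sft_cover_iff)
    next
      case False
      then have "z (p + d + int k) = v ! k" if "k < length v" for k
        using p[OF that] right[of "p + int k"] v by (simp add: algebra_simps)
      then have "occurs_in v z" unfolding occurs_in_def by blast
      then show ?thesis using z(1) v by (auto simp: sft_cover_iff)
    qed
  qed
  moreover have "g (i + int k) = (x @ u @ w) ! k" if k: "k < length (x @ u @ w)" for k
  proof (cases "k < length (x @ u)")
    case True
    then show ?thesis using y(2)[of k] assms(3) by (auto simp: g_def e_def nth_append)
  next
    case False
    define l where "l = k - length x"
    have l: "k = length x + l" "m \<le> l" "l < length (u @ w)" using False k assms(3) by (auto simp: l_def)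
    then have "g (i + int k) = z (j + int l)"
      using right[of "i + int k"] by (simp add: e_def d_def algebra_simps)
    then show ?thesis using z(2)[OF l(3)] l by (simp add: nth_append)
  qed
  ultimately show ?thesis by (auto simp: lang_iff occurs_in_def)
qed

lemma irreducible_sft_cover:
  fixes X :: "(int \<Rightarrow> 'a::finite) set"
  assumes "X \<noteq> {}" and "top_transitive X" and "1 \<le> m"
  shows "irreducible_markov_shift (sft_cover X m) m"
proof
  show "sft_cover X m \<noteq> {}" using assms(1) subset_sft_cover by blast
  fix u v assume "u \<in> lang_n m (sft_cover X m)" "v \<in> lang_n m (sft_cover X m)"
  then have "u \<in> lang X" "v \<in> lang X"
    using lang_sft_cover_short[OF assms(1)] by (auto simp: lang_n_iff)
  then obtain w where "u @ w @ v \<in> lang X"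
    using assms(2) unfolding top_transitive_def by blast
  then show "\<exists>w. u @ w @ v \<in> lang (sft_cover X m)" using lang_mono[OF subset_sft_cover] by blast
qed (use assms(3) in \<open>auto intro: sft_cover_glue\<close>)

text \<open>
  If the covers differ, a forbidden word \<open>P\<close> of length at most \<open>m + j\<close> occurs in the larger one. Its
  length exceeds \<open>m\<close>, since shorter words of that cover belong to the language of \<open>X\<close>.
\<close>

lemma sft_cover_entropy_gap:
  fixes X :: "(int \<Rightarrow> 'a::finite) set"
  assumes "X \<noteq> {}" and "top_transitive X" and "1 \<le> m"
    and neq: "sft_cover X m \<noteq> sft_cover X (m + j)"
  defines "s \<equiv> card (lang_n m (sft_cover X m))"
  shows "1 / (real (s\<^sup>2 + j) * real s ^ (2 * s\<^sup>2 + j))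
       \<le> h_top (sft_cover X m) - h_top (sft_cover X (m + j))"
proof -
  interpret irreducible_markov_shift "sft_cover X m" m
    by (rule irreducible_sft_cover[OF assms(1-3)])
  have "sft_cover X (m + j) \<subseteq> sft_cover X m" by (rule sft_cover_antimono) simp
  with neq obtain y where y: "y \<in> sft_cover X m" "y \<notin> sft_cover X (m + j)" by blast
  then obtain P where P: "1 \<le> length P" "length P \<le> m + j" "occurs_in P y" "P \<notin> lang X"
    by (auto simp: sft_cover_iff)
  have "m \<le> length P" using P y(1) by (force simp: sft_cover_iff)
  moreover have "P \<in> lang (sft_cover X m)" using P(3) y(1) by (auto simp: lang_iff)
  moreover have "P \<notin> lang (sft_cover X (m + j))"
    using lang_sft_cover_short[OF assms(1)] P by blast
  moreover have "sft_cover X (m + j) \<noteq> {}" using assms(1) subset_sft_cover by blast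
  ultimately show ?thesis
    using entropy_gap[of P j "sft_cover X (m + j)"] sft_cover_antimono[of m "m + j" X] P(2)
    by (simp add: s_def)
qed

section \<open>Comparison with the threshold of entropy stability\<close>

text \<open>
  The denominator in the definition of \<^const>\<open>xi\<close> lies strictly between 0 and 1.
\<close>

lemma xi_ge:
  assumes "1 \<le> s"
  shows "30 * real s ^ (3 * (s\<^sup>2 + 1)) \<le> xi s"
proof -
  define b where "b = 1 - 1 / (4 * real s ^ (2 * s\<^sup>2))"
  have "1 \<le> real s ^ (2 * s\<^sup>2)" using assms by (simp add: one_le_power)
  then have "1 < 4 * real s ^ (2 * s\<^sup>2)" by linarith
  then have b: "0 < b" "b < 1" using assms by (auto simp: b_def divide_less_eq)
  have r: "0 < 1 / real (s\<^sup>2)" using assms by simp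
  have "b powr (1 / real (s\<^sup>2)) < 1 powr (1 / real (s\<^sup>2))"
    by (rule powr_less_mono2[OF r]) (use b in auto)
  moreover have "0 < b powr (1 / real (s\<^sup>2))" using b by simp
  ultimately show ?thesis
    unfolding xi_def b_def[symmetric] using assms by (simp add: le_divide_eq mult_le_cancel_left1)
qed

text \<open>
  Up to a factor depending on \<open>j\<close> alone, \<open>(s\<^sup>2 + j) s ^ (2 s\<^sup>2 + j)\<close> is at most
  \<open>s ^ (6 s\<^sup>2 + 6)\<close>. The term to control is \<open>s ^ j\<close>: for \<open>s \<le> j + 1\<close> it is at most \<open>(j + 1) ^ j\<close>, and
  for larger \<open>s\<close> the inequality \<open>j \<le> 4 s\<^sup>2\<close> holds.
\<close>

lemma gap_ge_threshold:
  assumes "1 \<le> s"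
  shows "1 / (real (j + 1) ^ (j + 1) * (xi s)\<^sup>2)
       \<le> 1 / (real (s\<^sup>2 + j) * real s ^ (2 * s\<^sup>2 + j))"
proof -
  have s: "1 \<le> real s" using assms by simp
  have j_power: "real s ^ j \<le> real s ^ (4 * s\<^sup>2) * real (j + 1) ^ j"
  proof (cases "s \<le> j + 1")
    case True
    then have "real s ^ j \<le> real (j + 1) ^ j" by (intro power_mono) auto
    also have "\<dots> \<le> real s ^ (4 * s\<^sup>2) * real (j + 1) ^ j"
      using mult_right_mono[OF one_le_power[OF s], of "real (j + 1) ^ j" "4 * s\<^sup>2"] by simp
    finally show ?thesis .
  next
    case False
    have "s \<le> s\<^sup>2" by (simp add: power2_eq_square)
    with False have "j \<le> 4 * s\<^sup>2" by linarith
    then have "real s ^ j \<le> real s ^ (4 * s\<^sup>2)" by (intro power_increasing s)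
    also have "\<dots> \<le> real s ^ (4 * s\<^sup>2) * real (j + 1) ^ j"
      using mult_left_mono[OF one_le_power[of "real (j + 1)" j], of "real s ^ (4 * s\<^sup>2)"] by simp
    finally show ?thesis .
  qed
  have linear: "real (s\<^sup>2 + j) \<le> real s ^ 6 * real (j + 1)"
  proof -
    have "real s ^ 2 \<le> real s ^ 6" by (intro power_increasing s) simp
    moreover have "real j * 1 \<le> real j * real s ^ 6" by (intro mult_left_mono one_le_power s) simp
    ultimately show ?thesis by (simp add: algebra_simps)
  qed
  have "real (s\<^sup>2 + j) * real s ^ (2 * s\<^sup>2 + j)
      = real (s\<^sup>2 + j) * (real s ^ (2 * s\<^sup>2) * real s ^ j)"
    by (simp add: power_add)
  also have "\<dots> \<le> (real s ^ 6 * real (j + 1))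
      * (real s ^ (2 * s\<^sup>2) * (real s ^ (4 * s\<^sup>2) * real (j + 1) ^ j))"
    using linear j_power by (intro mult_mono) auto
  also have "\<dots> = real (j + 1) ^ (j + 1) * (real s ^ (3 * (s\<^sup>2 + 1)))\<^sup>2"
  proof -
    have "(real s ^ (3 * (s\<^sup>2 + 1)))\<^sup>2 = real s ^ (6 + 2 * s\<^sup>2 + 4 * s\<^sup>2)"
      by (simp add: add.commute flip: power_mult)
    also have "\<dots> = real s ^ 6 * real s ^ (2 * s\<^sup>2) * real s ^ (4 * s\<^sup>2)"
      by (simp only: power_add)
    finally show ?thesis by (simp only: power_add power_one_right mult_ac)
  qed
  also have "\<dots> \<le> real (j + 1) ^ (j + 1) * (xi s)\<^sup>2"
  proof (intro mult_left_mono power_mono)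
    show "real s ^ (3 * (s\<^sup>2 + 1)) \<le> xi s"
      using xi_ge[OF assms] zero_le_power[of "real s" "3 * (s\<^sup>2 + 1)"] by linarith
  qed auto
  finally have le: "real (s\<^sup>2 + j) * real s ^ (2 * s\<^sup>2 + j) \<le> real (j + 1) ^ (j + 1) * (xi s)\<^sup>2" .
  have "0 < s\<^sup>2 + j" using assms by simp
  then have pos: "0 < real (s\<^sup>2 + j) * real s ^ (2 * s\<^sup>2 + j)"
    using assms by (intro mult_pos_pos zero_less_power) (simp_all only: of_nat_0_less_iff)
  show ?thesis
    by (rule divide_left_mono[OF le]) (use pos le in \<open>auto intro!: mult_pos_pos\<close>)
qed

theorem theorem3p7:
  fixes X :: "(int \<Rightarrow> 'a::finite) set"
  assumes "subshift X" and "top_transitive X"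
  shows "language_stable X \<longleftrightarrow> entropy_stable X"
proof
  have ne: "X \<noteq> {}" using assms(1) by (simp add: subshift_def)
  have s_pos: "1 \<le> card (lang_n m (sft_cover X m))" for m
  proof -
    have "sft_cover X m \<noteq> {}" using ne subset_sft_cover by blast
    then show ?thesis using card_lang_n_pos[of "sft_cover X m" m] by linarith
  qed
  show "entropy_stable X" if stable: "language_stable X"
    unfolding entropy_stable_def
  proof (intro allI impI)
    fix \<epsilon> :: real and l j :: nat
    assume "\<epsilon> > 0"
    obtain m where m: "m \<ge> 1" "sft_cover X m = sft_cover X (m + j)"
      using stable unfolding language_stable_def by blast
    have "xi (card (lang_n m (sft_cover X m))) > 0"
      by (rule less_le_trans[OF _ xi_ge[OF s_pos]]) (use s_pos[of m] in simp)
    then have "0 < \<epsilon>\<^sup>2 / ((4/3) ^ (2 * l) * (xi (card (lang_n m (sft_cover X m))))\<^sup>2)"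
      using \<open>\<epsilon> > 0\<close> by simp
    with m(1) show "\<exists>m\<ge>1. \<bar>h_top (sft_cover X m) - h_top (sft_cover X (m + j))\<bar>
        < \<epsilon>\<^sup>2 / ((4/3) ^ (2 * l) * (xi (card (lang_n m (sft_cover X m))))\<^sup>2)"
      by (intro exI[of _ m]) (simp flip: m(2))
  qed
  show "language_stable X" if stable: "entropy_stable X"
    unfolding language_stable_def
  proof
    fix j :: nat
    show "\<exists>m\<ge>1. sft_cover X m = sft_cover X (m + j)"
    proof (cases "j = 0")
      case False
      define \<epsilon> where "\<epsilon> = sqrt (1 / real (j + 1) ^ (j + 1))"
      have \<epsilon>: "\<epsilon> > 0" "\<epsilon>\<^sup>2 = 1 / real (j + 1) ^ (j + 1)" by (auto simp: \<epsilon>_def)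
      obtain m where m: "m \<ge> 1"
        "\<bar>h_top (sft_cover X m) - h_top (sft_cover X (m + j))\<bar>
          < \<epsilon>\<^sup>2 / ((4/3) ^ (2 * 1) * (xi (card (lang_n m (sft_cover X m))))\<^sup>2)"
        using stable[unfolded entropy_stable_def, rule_format, of \<epsilon> 1 j] \<epsilon>(1) False by auto
      let ?s = "card (lang_n m (sft_cover X m))"
      have "sft_cover X m = sft_cover X (m + j)"
      proof (rule ccontr)
        assume "\<not> ?thesis"
        note gap = sft_cover_entropy_gap[OF ne assms(2) m(1) this]
        have "xi ?s > 0"
          by (rule less_le_trans[OF _ xi_ge[OF s_pos]]) (use s_pos[of m] in simp)
        then have "\<epsilon>\<^sup>2 / ((4/3) ^ (2 * 1) * (xi ?s)\<^sup>2) \<le> \<epsilon>\<^sup>2 / (xi ?s)\<^sup>2"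
          by (intro divide_left_mono) (auto simp: power2_eq_square)
        also have "\<dots> = 1 / (real (j + 1) ^ (j + 1) * (xi ?s)\<^sup>2)" by (simp add: \<epsilon>(2))
        also note gap_ge_threshold[OF s_pos]
        also note gap
        finally show False using m(2) by linarith
      qed
      with m(1) show ?thesis by (intro exI conjI)
    qed (auto intro: exI[of _ 1])
  qed
qed

end
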